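(* Given $V(\boldsymbol{x})$, $\epsilon>0$ and $\varphi_1(\boldsymbol{x})$, consider the terminal value problem in the unknown $\varphi(\boldsymbol{x},t)$, $\boldsymbol{x}\in\mathbb{R}^n$, $t\in[0,1]$: $$\frac{\partial\varphi}{\partial t}=\langle\nabla\varphi,\nabla V\rangle-\epsilon\Delta\varphi,\qquad \varphi(\boldsymbol{x},1)=\varphi_1(\boldsymbol{x}).$$ Let $s:=1-t$ and $q(\boldsymbol{x},s):=\varphi(\boldsymbol{x},t)=\varphi(\boldsymbol{x},1-s)$. Then $q$ satisfies the initial value problem $$\frac{\partial q}{\partial s}=-\langle\nabla q,\nabla V\rangle+\epsilon\Delta q,\qquad q(\boldsymbol{x},0)=\varphi_1(\boldsymbol{x}).$$ Further, $p(\boldsymbol{x},s):=q(\boldsymbol{x},s)\exp(-V(\boldsymbol{x})/\epsilon)$ satisfies the initial value problem $$\frac{\partial p}{\partial s}=\nabla\cdot(p\nabla V)+\epsilon\Delta p,\qquad p(\boldsymbol{x},0)=q(\boldsymbol{x},0)\exp(-V(\boldsymbol{x})/\epsilon),$$ where $q$ is a smooth solution of the initial value problem $\frac{\partial q}{\partial s}=-\langle\nabla q,\nabla V\rangle+\epsilon\Delta q$, $q(\boldsymbol{x},0)=\varphi_1(\boldsymbol{x})$, and $V$ is such that $$\int_{\mathbb{R}^n}q(\boldsymbol{x},0)\exp(-V(\boldsymbol{x})/\epsilon)\,d\boldsymbol{x}<\infty\quad\text{for all }\epsilon>0.$$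
   Context: $V:\mathbb{R}^n\to\mathbb{R}_{\ge0}$ is a $C^2(\mathbb{R}^n)$ function. $\nabla$, $\nabla\cdot$, $\Delta$ are the Euclidean gradient, divergence and Laplacian with respect to $\boldsymbol{x}\in\mathbb{R}^n$, and $\langle\cdot,\cdot\rangle$ is the standard Euclidean inner product. *)

theory Defs
  imports "HOL-Analysis.Analysis"
begin

definition partial_deriv :: "'n::finite \<Rightarrow> (real^'n \<Rightarrow> real) \<Rightarrow> real^'n \<Rightarrow> real" where
  "partial_deriv i f x = deriv (\<lambda>h. f (x + h *\<^sub>R axis i 1)) 0"

definition gradient :: "(real^'n::finite \<Rightarrow> real) \<Rightarrow> real^'n \<Rightarrow> real^'n" where
  "gradient f x = (\<chi> i. partial_deriv i f x)"

definition divergence :: "(real^'n::finite \<Rightarrow> real^'n) \<Rightarrow> real^'n \<Rightarrow> real" where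
  "divergence F x = (\<Sum>i\<in>UNIV. partial_deriv i (\<lambda>y. F y $ i) x)"

definition laplacian :: "(real^'n::finite \<Rightarrow> real) \<Rightarrow> real^'n \<Rightarrow> real" where
  "laplacian f x = divergence (gradient f) x"

definition C1 :: "(real^'n::finite \<Rightarrow> real) \<Rightarrow> bool" where
  "C1 f \<longleftrightarrow> (\<forall>x. f differentiable (at x)) \<and> (\<forall>i. continuous_on UNIV (partial_deriv i f))"

definition C2 :: "(real^'n::finite \<Rightarrow> real) \<Rightarrow> bool" where
  "C2 f \<longleftrightarrow> C1 f \<and> (\<forall>i. C1 (partial_deriv i f))"

text \<open>\<open>partial_deriv\<close> and \<open>gradient\<close> are total, so they carry a junk value where the derivative
  does not exist. For differentiable functions they agree with the library's gradient.\<close>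

lemma gderiv_gradient:
  assumes "f differentiable (at x)"
  shows "GDERIV f x :> gradient f x"
proof -
  obtain f' where f': "(f has_derivative f') (at x)"
    using assms by (auto simp: differentiable_def)
  interpret f': bounded_linear f'
    using f' by (rule has_derivative_bounded_linear)
  have pd: "partial_deriv i f x = f' (axis i 1)" for i
  proof -
    have g: "((\<lambda>h::real. x + h *\<^sub>R axis i 1) has_derivative (\<lambda>h. h *\<^sub>R axis i 1)) (at 0)"
      by (auto intro!: derivative_eq_intros)
    have "(f has_derivative f') (at (x + 0 *\<^sub>R axis i 1))"
      using f' by simp
    from has_derivative_compose[OF g this]
    have "((\<lambda>h. f (x + h *\<^sub>R axis i 1)) has_derivative (\<lambda>h. f' (axis i 1) * h)) (at 0)"
      by (simp add: f'.scaleR mult.commute)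
    then show ?thesis
      unfolding partial_deriv_def by (intro DERIV_imp_deriv) (simp add: has_field_derivative_def)
  qed
  have "f' h = h \<bullet> gradient f x" for h
  proof -
    have "f' h = f' (\<Sum>i\<in>UNIV. (h $ i) *\<^sub>R axis i 1)"
      using basis_expansion[of h] by (simp add: scalar_mult_eq_scaleR)
    also have "\<dots> = h \<bullet> gradient f x"
      by (simp add: f'.sum f'.scaleR inner_vec_def gradient_def pd)
    finally show ?thesis .
  qed
  then have "f' = (\<lambda>h. h \<bullet> gradient f x)" by blast
  with f' show ?thesis by (simp add: gderiv_def)
qed

text \<open>Space-time functions are \<open>u x t\<close> with \<open>x\<close> in Euclidean space and \<open>t\<close> in \<open>[0,1]\<close>.
  Values at times outside \<open>[0,1]\<close> play no role; at the endpoints the time derivative is one-sided.\<close>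

definition time_deriv :: "(real^'n::finite \<Rightarrow> real \<Rightarrow> real) \<Rightarrow> real^'n \<Rightarrow> real \<Rightarrow> real" where
  "time_deriv u x t = vector_derivative (u x) (at t within {0..1})"

text \<open>The class \<open>C\<^sup>2\<^sup>,\<^sup>1\<close> of classical solutions of second-order parabolic equations: twice
  continuously differentiable in space and once in time, jointly up to both time endpoints.\<close>

definition C21 :: "(real^'n::finite \<Rightarrow> real \<Rightarrow> real) \<Rightarrow> bool" where
  "C21 u \<longleftrightarrow>
     (\<forall>t\<in>{0..1}. C2 (\<lambda>x. u x t)) \<and>
     (\<forall>x. \<forall>t\<in>{0..1}. u x differentiable (at t within {0..1})) \<and>
     continuous_on (UNIV \<times> {0..1}) (\<lambda>(x, t). u x t) \<and>
     continuous_on (UNIV \<times> {0..1}) (\<lambda>(x, t). time_deriv u x t) \<and>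
     (\<forall>i. continuous_on (UNIV \<times> {0..1}) (\<lambda>(x, t). partial_deriv i (\<lambda>y. u y t) x)) \<and>
     (\<forall>i j. continuous_on (UNIV \<times> {0..1})
        (\<lambda>(x, t). partial_deriv j (partial_deriv i (\<lambda>y. u y t)) x))"

definition solves_TVP ::
  "(real^'n::finite \<Rightarrow> real) \<Rightarrow> real \<Rightarrow> (real^'n \<Rightarrow> real) \<Rightarrow> (real^'n \<Rightarrow> real \<Rightarrow> real) \<Rightarrow> bool" where
  "solves_TVP V \<epsilon> \<phi>\<^sub>1 \<phi> \<longleftrightarrow>
     C21 \<phi> \<and>
     (\<forall>x. \<forall>t\<in>{0..1}. time_deriv \<phi> x t =
        gradient (\<lambda>y. \<phi> y t) x \<bullet> gradient V x - \<epsilon> * laplacian (\<lambda>y. \<phi> y t) x) \<and>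
     (\<forall>x. \<phi> x 1 = \<phi>\<^sub>1 x)"

definition solves_IVP ::
  "(real^'n::finite \<Rightarrow> real) \<Rightarrow> real \<Rightarrow> (real^'n \<Rightarrow> real) \<Rightarrow> (real^'n \<Rightarrow> real \<Rightarrow> real) \<Rightarrow> bool" where
  "solves_IVP V \<epsilon> q\<^sub>0 q \<longleftrightarrow>
     C21 q \<and>
     (\<forall>x. \<forall>s\<in>{0..1}. time_deriv q x s =
        - (gradient (\<lambda>y. q y s) x \<bullet> gradient V x) + \<epsilon> * laplacian (\<lambda>y. q y s) x) \<and>
     (\<forall>x. q x 0 = q\<^sub>0 x)"

definition solves_Fokker_Planck_IVP ::
  "(real^'n::finite \<Rightarrow> real) \<Rightarrow> real \<Rightarrow> (real^'n \<Rightarrow> real) \<Rightarrow> (real^'n \<Rightarrow> real \<Rightarrow> real) \<Rightarrow> bool" where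
  "solves_Fokker_Planck_IVP V \<epsilon> p\<^sub>0 p \<longleftrightarrow>
     C21 p \<and>
     (\<forall>x. \<forall>s\<in>{0..1}. time_deriv p x s =
        divergence (\<lambda>y. p y s *\<^sub>R gradient V y) x + \<epsilon> * laplacian (\<lambda>y. p y s) x) \<and>
     (\<forall>x. p x 0 = p\<^sub>0 x)"

end

theory Submission
  imports Defs
begin

text \<open>Time reversal \<open>s = 1 - t\<close> maps \<open>[0,1]\<close> onto itself, leaves all spatial derivatives alone and
  flips the sign of the time derivative; this is the first claim. For the second, write
  \<open>W = exp (- V / \<epsilon>)\<close>, so that \<open>\<epsilon> \<nabla>W = - W \<nabla>V\<close>. For \<open>p = q W\<close> the product rule then gives
  \<open>\<epsilon> \<nabla>p + p \<nabla>V = \<epsilon> W \<nabla>q\<close>, and taking the divergence,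
  \<open>\<epsilon> \<Delta>p + \<nabla>\<cdot>(p \<nabla>V) = W (\<epsilon> \<Delta>q - \<langle>\<nabla>q, \<nabla>V\<rangle>)\<close>, which is \<open>W\<close> times the right-hand side of the
  equation for \<open>q\<close> (lemma \<open>Fokker_Planck_operator_weighted\<close>). As \<open>W\<close> does not depend on time,
  this equals the time derivative of \<open>p\<close>.

  Solutions are classical, so one also needs that \<open>C21\<close> is closed under time reversal and under
  multiplication by a time-independent \<open>C2\<close> function (lemmas \<open>C21_time_reversal\<close> and
  \<open>C21_mult_C2\<close>), and that \<open>W\<close> is \<open>C2\<close>.\<close>

section \<open>Calculus of partial derivatives\<close>

lemma partial_deriv_eqI:
  assumes "((\<lambda>h. f (x + h *\<^sub>R axis i 1)) has_real_derivative D) (at 0)"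
  shows "partial_deriv i f x = D"
  using assms unfolding partial_deriv_def by (rule DERIV_imp_deriv)

lemma has_real_derivative_partial_deriv:
  fixes f :: "real^'n::finite \<Rightarrow> real"
  assumes "f differentiable (at x)"
  shows "((\<lambda>h. f (x + h *\<^sub>R axis i 1)) has_real_derivative partial_deriv i f x) (at 0)"
proof -
  have "(\<lambda>h::real. x + h *\<^sub>R axis i 1) differentiable (at 0)"
    by (auto intro!: derivative_intros)
  then have "(f \<circ> (\<lambda>h::real. x + h *\<^sub>R axis i 1)) differentiable (at 0)"
    by (rule differentiable_chain_at) (simp add: assms)
  then have "(\<lambda>h. f (x + h *\<^sub>R axis i 1)) differentiable (at 0)"
    by (simp add: o_def)
  then show ?thesis
    unfolding partial_deriv_def
    by (metis DERIV_deriv_iff_real_differentiable)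
qed

lemma partial_deriv_add:
  fixes f g :: "real^'n::finite \<Rightarrow> real"
  assumes "f differentiable (at x)" "g differentiable (at x)"
  shows "partial_deriv i (\<lambda>y. f y + g y) x = partial_deriv i f x + partial_deriv i g x"
  by (intro partial_deriv_eqI DERIV_add has_real_derivative_partial_deriv assms)

lemma partial_deriv_mult:
  fixes f g :: "real^'n::finite \<Rightarrow> real"
  assumes "f differentiable (at x)" "g differentiable (at x)"
  shows "partial_deriv i (\<lambda>y. f y * g y) x = partial_deriv i f x * g x + f x * partial_deriv i g x"
  using DERIV_mult[OF has_real_derivative_partial_deriv[OF assms(1), of i]
      has_real_derivative_partial_deriv[OF assms(2), of i]]
  by (intro partial_deriv_eqI) (simp add: algebra_simps)

lemma partial_deriv_cmult:
  fixes f :: "real^'n::finite \<Rightarrow> real"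
  assumes "f differentiable (at x)"
  shows "partial_deriv i (\<lambda>y. c * f y) x = c * partial_deriv i f x"
  by (intro partial_deriv_eqI DERIV_cmult has_real_derivative_partial_deriv assms)

lemma partial_deriv_exp:
  fixes f :: "real^'n::finite \<Rightarrow> real"
  assumes "f differentiable (at x)"
  shows "partial_deriv i (\<lambda>y. exp (f y)) x = partial_deriv i f x * exp (f x)"
  using DERIV_fun_exp[OF has_real_derivative_partial_deriv[OF assms, of i]]
  by (intro partial_deriv_eqI) (simp add: mult.commute)

section \<open>Closure properties of the classes of continuously differentiable functions\<close>

lemma C1_differentiable: "C1 f \<Longrightarrow> f differentiable (at x)"
  by (simp add: C1_def)

lemma C1_continuous_on_partial_deriv: "C1 f \<Longrightarrow> continuous_on UNIV (partial_deriv i f)"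
  by (simp add: C1_def)

lemma C1_continuous_on: "C1 f \<Longrightarrow> continuous_on UNIV f"
  by (simp add: C1_def continuous_at_imp_continuous_on differentiable_imp_continuous_within)

lemma C2_C1: "C2 f \<Longrightarrow> C1 f"
  by (simp add: C2_def)

lemma C2_C1_partial_deriv: "C2 f \<Longrightarrow> C1 (partial_deriv i f)"
  by (simp add: C2_def)

lemma C1_add:
  assumes "C1 f" "C1 g"
  shows "C1 (\<lambda>x. f x + g x)"
proof -
  have "partial_deriv i (\<lambda>x. f x + g x) = (\<lambda>x. partial_deriv i f x + partial_deriv i g x)" for i
    using assms by (auto simp: partial_deriv_add C1_differentiable)
  with assms show ?thesis
    by (auto simp: C1_def intro!: continuous_intros differentiable_add)
qed

lemma C1_mult:
  assumes "C1 f" "C1 g"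
  shows "C1 (\<lambda>x. f x * g x)"
proof -
  have "partial_deriv i (\<lambda>x. f x * g x)
      = (\<lambda>x. partial_deriv i f x * g x + f x * partial_deriv i g x)" for i
    using assms by (auto simp: partial_deriv_mult C1_differentiable)
  with assms C1_continuous_on[OF assms(1)] C1_continuous_on[OF assms(2)] show ?thesis
    by (auto simp: C1_def intro!: continuous_intros differentiable_mult)
qed

lemma C1_cmult:
  assumes "C1 f"
  shows "C1 (\<lambda>x. c * f x)"
proof -
  have "partial_deriv i (\<lambda>x. c * f x) = (\<lambda>x. c * partial_deriv i f x)" for i
    using assms by (auto simp: partial_deriv_cmult C1_differentiable)
  with assms show ?thesis
    by (auto simp: C1_def intro!: continuous_intros differentiable_mult)
qed

lemma C1_exp:
  assumes "C1 f"
  shows "C1 (\<lambda>x. exp (f x))"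
proof -
  have "partial_deriv i (\<lambda>x. exp (f x)) = (\<lambda>x. partial_deriv i f x * exp (f x))" for i
    using assms by (auto simp: partial_deriv_exp C1_differentiable)
  moreover have "(\<lambda>x. exp (f x)) differentiable (at x)" for x
    using differentiable_chain_at[OF C1_differentiable[OF assms, of x], of exp]
    by (simp add: o_def field_differentiable_imp_differentiable field_differentiable_within_exp)
  ultimately show ?thesis
    using C1_continuous_on[OF assms] assms
    by (auto simp: C1_def intro!: continuous_intros)
qed

lemma C2_mult:
  assumes "C2 f" "C2 g"
  shows "C2 (\<lambda>x. f x * g x)"
proof -
  have "partial_deriv i (\<lambda>x. f x * g x)
      = (\<lambda>x. partial_deriv i f x * g x + f x * partial_deriv i g x)" for i
    using assms by (auto simp: partial_deriv_mult C1_differentiable C2_C1)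
  with assms show ?thesis
    by (auto simp: C2_def intro!: C1_add C1_mult)
qed

lemma C2_cmult:
  assumes "C2 f"
  shows "C2 (\<lambda>x. c * f x)"
proof -
  have "partial_deriv i (\<lambda>x. c * f x) = (\<lambda>x. c * partial_deriv i f x)" for i
    using assms by (auto simp: partial_deriv_cmult C1_differentiable C2_C1)
  with assms show ?thesis
    by (auto simp: C2_def intro!: C1_cmult)
qed

lemma C2_exp:
  assumes "C2 f"
  shows "C2 (\<lambda>x. exp (f x))"
proof -
  have "partial_deriv i (\<lambda>x. exp (f x)) = (\<lambda>x. partial_deriv i f x * exp (f x))" for i
    using assms by (auto simp: partial_deriv_exp C1_differentiable C2_C1)
  with assms show ?thesis
    by (auto simp: C2_def intro!: C1_exp C1_mult)
qed

lemma partial_deriv2_mult: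
  assumes "C2 f" "C2 g"
  shows "partial_deriv j (partial_deriv i (\<lambda>x. f x * g x)) x =
    partial_deriv j (partial_deriv i f) x * g x + partial_deriv i f x * partial_deriv j g x +
    (partial_deriv j f x * partial_deriv i g x + f x * partial_deriv j (partial_deriv i g) x)"
proof -
  note C1s = assms[THEN C2_C1] assms[THEN C2_C1_partial_deriv]
  have "partial_deriv i (\<lambda>x. f x * g x)
      = (\<lambda>x. partial_deriv i f x * g x + f x * partial_deriv i g x)"
    using C1s by (auto simp: partial_deriv_mult C1_differentiable)
  then show ?thesis
    using C1s by (simp add: partial_deriv_add partial_deriv_mult C1_differentiable C1_mult)
qed

section \<open>Time derivatives and space-time regularity\<close>

lemma time_deriv_eqI:
  assumes "(u x has_vector_derivative D) (at t within {0..1})" "t \<in> {0..1}"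
  shows "time_deriv u x t = D"
  using assms vector_derivative_within_cbox[of 0 1 t "u x" D]
  by (simp add: time_deriv_def)

lemma has_vector_derivative_time_deriv:
  assumes "u x differentiable (at t within {0..1})"
  shows "(u x has_vector_derivative time_deriv u x t) (at t within {0..1})"
  using assms by (simp add: time_deriv_def vector_derivative_works)

lemma has_vector_derivative_time_reversal:
  assumes "u x differentiable (at (1 - s) within {0..1})"
  shows "((\<lambda>s. u x (1 - s)) has_vector_derivative - time_deriv u x (1 - s)) (at s within {0..1})"
proof -
  have "(\<lambda>s. 1 - s) ` {0..1::real} = {0..1}"
    by (auto simp: image_iff intro: bexI[of _ "1 - _"])
  then have "(u x has_vector_derivative time_deriv u x (1 - s))
      (at (1 - s) within (\<lambda>s. 1 - s) ` {0..1})"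
    using has_vector_derivative_time_deriv[of u x, OF assms] by simp
  moreover have "((\<lambda>s. 1 - s) has_vector_derivative -1) (at s within {0..1::real})"
    by (auto intro!: derivative_eq_intros)
  ultimately show ?thesis
    using vector_diff_chain_within[of "\<lambda>s. 1 - s" "-1" s "{0..1}" "u x"] by (simp add: o_def)
qed

lemma time_deriv_time_reversal:
  assumes "C21 u" "s \<in> {0..1}"
  shows "time_deriv (\<lambda>x s. u x (1 - s)) x s = - time_deriv u x (1 - s)"
  using assms by (intro time_deriv_eqI has_vector_derivative_time_reversal) (auto simp: C21_def)

lemma C21_time_reversal:
  fixes u :: "real^'n::finite \<Rightarrow> real \<Rightarrow> real"
  assumes "C21 u"
  shows "C21 (\<lambda>x s. u x (1 - s))"
proof -
  have reversal: "continuous_on (UNIV \<times> {0..1}) (\<lambda>(x, s). g x (1 - s))"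
    if "continuous_on (UNIV \<times> {0..1}) (\<lambda>(x, t). g x t)" for g :: "real^'n \<Rightarrow> real \<Rightarrow> real"
  proof -
    have "continuous_on (UNIV \<times> {0..1::real}) (\<lambda>z. (\<lambda>(x, t). g x t) (fst z, 1 - snd z))"
      by (rule continuous_on_compose2[OF that]) (auto intro!: continuous_intros)
    then show ?thesis by (simp add: case_prod_unfold)
  qed
  have "continuous_on (UNIV \<times> {0..1}) (\<lambda>(x, s). - time_deriv u x (1 - s))"
    using continuous_on_minus[OF reversal[of "time_deriv u"]] assms
    by (simp add: C21_def case_prod_unfold)
  then have "continuous_on (UNIV \<times> {0..1}) (\<lambda>(x, s). time_deriv (\<lambda>x s. u x (1 - s)) x s)"
    by (rule continuous_on_eq) (auto simp: time_deriv_time_reversal[OF assms])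
  moreover have "(\<lambda>s. u x (1 - s)) differentiable (at s within {0..1})" if "s \<in> {0..1}" for x s
    using assms that has_vector_derivative_time_reversal[of u x s]
    by (auto simp: C21_def intro: differentiableI_vector)
  moreover have "C2 (\<lambda>x. u x (1 - s))" if "s \<in> {0..1}" for s
    using assms that by (auto simp: C21_def)
  ultimately show ?thesis
    using assms unfolding C21_def by (auto intro!: reversal)
qed

lemma has_vector_derivative_mult_time_independent:
  assumes "u x differentiable (at t within {0..1})"
  shows "((\<lambda>t. u x t * w x) has_vector_derivative time_deriv u x t * w x) (at t within {0..1})"
  using has_vector_derivative_mult_left[OF has_vector_derivative_time_deriv[of u x, OF assms]]
  by simp

lemma time_deriv_mult_time_independent:
  assumes "C21 u" "t \<in> {0..1}"
  shows "time_deriv (\<lambda>x t. u x t * w x) x t = time_deriv u x t * w x"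
  using assms
  by (intro time_deriv_eqI has_vector_derivative_mult_time_independent) (auto simp: C21_def)

lemma C21_mult_C2:
  fixes u :: "real^'n::finite \<Rightarrow> real \<Rightarrow> real"
  assumes u: "C21 u" and w: "C2 w"
  shows "C21 (\<lambda>x t. u x t * w x)"
proof -
  let ?S = "UNIV \<times> {0..1} :: ((real^'n) \<times> real) set"
  have C2u: "C2 (\<lambda>x. u x t)" if "t \<in> {0..1}" for t
    using u that by (simp add: C21_def)
  have lift: "continuous_on ?S (\<lambda>z. g (fst z))"
    if "continuous_on UNIV g" for g :: "real^'n \<Rightarrow> real"
    by (rule continuous_on_compose2[OF that]) (auto intro!: continuous_intros)
  have w_cont: "continuous_on ?S (\<lambda>z. w (fst z))"
    "continuous_on ?S (\<lambda>z. partial_deriv i w (fst z))"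
    "continuous_on ?S (\<lambda>z. partial_deriv j (partial_deriv i w) (fst z))" for i j
    using w by (auto intro!: lift C1_continuous_on C1_continuous_on_partial_deriv C2_C1
        C2_C1_partial_deriv)
  have u_cont: "continuous_on ?S (\<lambda>z. u (fst z) (snd z))"
    "continuous_on ?S (\<lambda>z. time_deriv u (fst z) (snd z))"
    "continuous_on ?S (\<lambda>z. partial_deriv i (\<lambda>y. u y (snd z)) (fst z))"
    "continuous_on ?S (\<lambda>z. partial_deriv j (partial_deriv i (\<lambda>y. u y (snd z))) (fst z))" for i j
    using u by (auto simp: C21_def case_prod_unfold)
  have "continuous_on ?S (\<lambda>(x, t). u x t * w x)"
    using u_cont w_cont by (auto simp: case_prod_unfold intro!: continuous_intros)
  moreover have "continuous_on ?S (\<lambda>(x, t). time_deriv (\<lambda>x t. u x t * w x) x t)"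
  proof (rule continuous_on_eq)
    show "continuous_on ?S (\<lambda>z. time_deriv u (fst z) (snd z) * w (fst z))"
      using u_cont w_cont by (intro continuous_intros)
  qed (auto simp: time_deriv_mult_time_independent[OF u])
  moreover have "continuous_on ?S (\<lambda>(x, t). partial_deriv i (\<lambda>y. u y t * w y) x)" for i
  proof (rule continuous_on_eq)
    show "continuous_on ?S (\<lambda>z. partial_deriv i (\<lambda>y. u y (snd z)) (fst z) * w (fst z) +
        u (fst z) (snd z) * partial_deriv i w (fst z))"
      using u_cont w_cont by (intro continuous_intros)
  qed (use C2u w in \<open>auto simp: partial_deriv_mult C1_differentiable C2_C1\<close>)
  moreover have "continuous_on ?S
      (\<lambda>(x, t). partial_deriv j (partial_deriv i (\<lambda>y. u y t * w y)) x)" for i j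
  proof (rule continuous_on_eq)
    show "continuous_on ?S (\<lambda>z.
        partial_deriv j (partial_deriv i (\<lambda>y. u y (snd z))) (fst z) * w (fst z) +
        partial_deriv i (\<lambda>y. u y (snd z)) (fst z) * partial_deriv j w (fst z) +
        (partial_deriv j (\<lambda>y. u y (snd z)) (fst z) * partial_deriv i w (fst z) +
         u (fst z) (snd z) * partial_deriv j (partial_deriv i w) (fst z)))"
      using u_cont w_cont by (intro continuous_intros)
  qed (use C2u w in \<open>auto simp: partial_deriv2_mult\<close>)
  moreover have "(\<lambda>t. u x t * w x) differentiable (at t within {0..1})" if "t \<in> {0..1}" for x t
    using u that has_vector_derivative_mult_time_independent[of u x t w]
    by (auto simp: C21_def intro: differentiableI_vector)
  ultimately show ?thesis
    using C2u w unfolding C21_def by (auto intro!: C2_mult)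
qed

section \<open>The Fokker--Planck operator and the Gibbs weight\<close>

lemma laplacian_eq_sum: "laplacian f x = (\<Sum>i\<in>UNIV. partial_deriv i (partial_deriv i f) x)"
  by (simp add: laplacian_def divergence_def gradient_def)

lemma C2_exp_potential:
  assumes "C2 V"
  shows "C2 (\<lambda>x. exp (- V x / \<epsilon>))"
  using C2_exp[OF C2_cmult[OF assms, of "- inverse \<epsilon>"]] by (simp add: field_simps)

lemma partial_deriv_exp_potential:
  assumes "V differentiable (at x)"
  shows "partial_deriv i (\<lambda>y. exp (- V y / \<epsilon>)) x = - partial_deriv i V x / \<epsilon> * exp (- V x / \<epsilon>)"
proof -
  have "(\<lambda>y. - inverse \<epsilon> * V y) differentiable (at x)"
    using assms by (intro differentiable_mult) auto
  then have "partial_deriv i (\<lambda>y. exp (- inverse \<epsilon> * V y)) x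
      = - inverse \<epsilon> * partial_deriv i V x * exp (- inverse \<epsilon> * V x)"
    by (simp only: partial_deriv_exp partial_deriv_cmult[OF assms])
  then show ?thesis by (simp add: field_simps)
qed

text \<open>The Gibbs weight conjugates the Fokker--Planck operator to the backward Kolmogorov operator.\<close>

lemma Fokker_Planck_operator_weighted:
  fixes V f :: "real^'n::finite \<Rightarrow> real"
  assumes V: "C2 V" and f: "C2 f" and \<epsilon>: "\<epsilon> \<noteq> 0"
  defines "W \<equiv> \<lambda>x. exp (- V x / \<epsilon>)"
  shows "divergence (\<lambda>y. (f y * W y) *\<^sub>R gradient V y) x + \<epsilon> * laplacian (\<lambda>y. f y * W y) x =
    (- (gradient f x \<bullet> gradient V x) + \<epsilon> * laplacian f x) * W x"
proof -
  let ?p = "\<lambda>y. f y * W y"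
  have W: "C2 W"
    unfolding W_def by (rule C2_exp_potential[OF V])
  have dW: "partial_deriv i W y = - partial_deriv i V y / \<epsilon> * W y" for i y
    unfolding W_def using V by (intro partial_deriv_exp_potential C1_differentiable C2_C1)
  have p: "C2 ?p"
    using f W by (rule C2_mult)
  note C1s = V[THEN C2_C1] f[THEN C2_C1] W[THEN C2_C1] p[THEN C2_C1]
    V[THEN C2_C1_partial_deriv] f[THEN C2_C1_partial_deriv] p[THEN C2_C1_partial_deriv]
  have component: "partial_deriv i (\<lambda>y. ?p y * partial_deriv i V y) x +
      \<epsilon> * partial_deriv i (partial_deriv i ?p) x =
      (- (partial_deriv i f x * partial_deriv i V x) + \<epsilon> * partial_deriv i (partial_deriv i f) x)
        * W x" for i
  proof -
    have "partial_deriv i (\<lambda>y. ?p y * partial_deriv i V y) x +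
        \<epsilon> * partial_deriv i (partial_deriv i ?p) x =
        partial_deriv i (\<lambda>y. ?p y * partial_deriv i V y + \<epsilon> * partial_deriv i ?p y) x"
      using C1s by (simp only: partial_deriv_add partial_deriv_cmult C1_differentiable
          C1_mult C1_cmult)
    \<comment> \<open>The two terms containing \<open>\<partial>\<^sub>i V\<close> cancel, because \<open>\<epsilon> \<partial>\<^sub>i W = - W \<partial>\<^sub>i V\<close>.\<close>
    also have "(\<lambda>y. ?p y * partial_deriv i V y + \<epsilon> * partial_deriv i ?p y)
        = (\<lambda>y. \<epsilon> * (partial_deriv i f y * W y))"
      using C1s \<epsilon> by (simp add: partial_deriv_mult C1_differentiable dW field_simps)
    also have "partial_deriv i \<dots> x =
        \<epsilon> * (partial_deriv i (partial_deriv i f) x * W x + partial_deriv i f x * partial_deriv i W x)"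
      using C1s by (simp only: partial_deriv_cmult partial_deriv_mult C1_differentiable C1_mult)
    also have "\<dots> = (- (partial_deriv i f x * partial_deriv i V x) +
        \<epsilon> * partial_deriv i (partial_deriv i f) x) * W x"
      using \<epsilon> by (simp add: dW field_simps)
    finally show ?thesis .
  qed
  have "divergence (\<lambda>y. ?p y *\<^sub>R gradient V y) x + \<epsilon> * laplacian ?p x =
      (\<Sum>i\<in>UNIV. partial_deriv i (\<lambda>y. ?p y * partial_deriv i V y) x +
        \<epsilon> * partial_deriv i (partial_deriv i ?p) x)"
    by (simp add: divergence_def laplacian_eq_sum gradient_def sum.distrib sum_distrib_left)
  also have "\<dots> = (- (gradient f x \<bullet> gradient V x) + \<epsilon> * laplacian f x) * W x"
    unfolding component
    by (simp add: laplacian_eq_sum gradient_def inner_vec_def sum.distrib sum_negf sum_subtractf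
        sum_distrib_left flip: sum_distrib_right)
  finally show ?thesis .
qed

section \<open>Transforming the terminal value problem\<close>

lemma solves_IVP_time_reversal:
  assumes "solves_TVP V \<epsilon> \<phi>\<^sub>1 \<phi>"
  shows "solves_IVP V \<epsilon> \<phi>\<^sub>1 (\<lambda>x s. \<phi> x (1 - s))"
  using assms
  by (auto simp: solves_TVP_def solves_IVP_def C21_time_reversal time_deriv_time_reversal)

lemma solves_Fokker_Planck_IVP_weighted:
  assumes "C2 V" "\<epsilon> \<noteq> 0" and q: "solves_IVP V \<epsilon> q\<^sub>0 q"
  shows "solves_Fokker_Planck_IVP V \<epsilon> (\<lambda>x. q x 0 * exp (- V x / \<epsilon>))
    (\<lambda>x s. q x s * exp (- V x / \<epsilon>))"
proof -
  have C21q: "C21 q"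
    using q by (simp add: solves_IVP_def)
  have q_eq: "time_deriv q x s
      = - (gradient (\<lambda>y. q y s) x \<bullet> gradient V x) + \<epsilon> * laplacian (\<lambda>y. q y s) x"
    if "s \<in> {0..1}" for x s
    using q that by (auto simp: solves_IVP_def)
  have C2q: "C2 (\<lambda>y. q y s)" if "s \<in> {0..1}" for s
    using C21q that by (simp add: C21_def)
  show ?thesis
    unfolding solves_Fokker_Planck_IVP_def
  proof (intro conjI allI ballI)
    show "C21 (\<lambda>x s. q x s * exp (- V x / \<epsilon>))"
      using C21q C2_exp_potential[OF assms(1)] by (rule C21_mult_C2)
  next
    fix x and s :: real
    assume s: "s \<in> {0..1}"
    show "time_deriv (\<lambda>x s. q x s * exp (- V x / \<epsilon>)) x s =
        divergence (\<lambda>y. (q y s * exp (- V y / \<epsilon>)) *\<^sub>R gradient V y) x +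
        \<epsilon> * laplacian (\<lambda>y. q y s * exp (- V y / \<epsilon>)) x"
      by (simp only: time_deriv_mult_time_independent[OF C21q s] q_eq[OF s]
          Fokker_Planck_operator_weighted[OF assms(1) C2q[OF s] assms(2)])
  qed simp
qed

theorem theorem3:
  fixes V \<phi>\<^sub>1 :: "real^'n::finite \<Rightarrow> real" and \<epsilon> :: real
  assumes "C2 V" and "\<And>x. V x \<ge> 0" and "\<epsilon> > 0"
  shows "(\<forall>\<phi>. solves_TVP V \<epsilon> \<phi>\<^sub>1 \<phi> \<longrightarrow> solves_IVP V \<epsilon> \<phi>\<^sub>1 (\<lambda>x s. \<phi> x (1 - s))) \<and>
    (\<forall>q. solves_IVP V \<epsilon> \<phi>\<^sub>1 q \<and>
         (\<forall>\<delta>>0. integrable lborel (\<lambda>x. q x 0 * exp (- V x / \<delta>))) \<longrightarrow>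
       solves_Fokker_Planck_IVP V \<epsilon> (\<lambda>x. q x 0 * exp (- V x / \<epsilon>))
         (\<lambda>x s. q x s * exp (- V x / \<epsilon>)))"
  using assms(1,3) solves_IVP_time_reversal solves_Fokker_Planck_IVP_weighted by fastforce

end
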